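(* Let $1\le p<\infty$, $\alpha>0$, $\rho_y\in\mathcal{P}(\mathbb{R}^n)$, and let $\mathcal{G}:\Theta\subset\mathbb{R}^m\to\mathcal{R}\subset\mathbb{R}^n$ be a measurable forward map, where $\Theta$ and its range $\mathcal{R}=\mathcal{G}(\Theta)$ are compact. Then the minimizer $\rho_x^*$ of the problem $$\min_{\rho_x\in\mathcal{P}_p(\Theta)}\ \mathcal{W}_p^p(\mathcal{G}_\#\rho_x,\rho_y)+\alpha\int|x|^p\,\mathrm{d}\rho_x(x)$$ is given by $$\rho_x^*=\tilde{\mathcal{F}}^\alpha_\#\rho_y,$$ i.e. $\tilde{\mathcal{F}}^\alpha_\#\rho_y$ solves the problem, where $\tilde{\mathcal{F}}^\alpha:\mathbb{R}^n\to\Theta$ is the map $$\tilde{\mathcal{F}}^\alpha(y)=\operatorname{arg\,min}_{x\in\Theta}\left\{|\mathcal{G}(x)-y|^p+\alpha|x|^p\right\}.$$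
   Context: $\mathcal{P}_p(\Theta)$ is the set of probability measures on $\Theta$ with finite $p$-th moment, $\#$ denotes pushforward, and $\mathcal{W}_p(\mu,\nu)=\left(\min_{\gamma\in\Gamma(\mu,\nu)}\int|y-y'|^p\,\mathrm{d}\gamma(y,y')\right)^{1/p}$ where $\Gamma(\mu,\nu)$ is the set of couplings of $\mu$ and $\nu$; $|\cdot|$ is the norm on the respective space. The minimization problem is assumed to be well-posed, and the pointwise minimizers defining $\tilde{\mathcal{F}}^\alpha$ are assumed to exist; uniqueness is not required, and if there are several minimizers one is free to select one, so $\tilde{\mathcal{F}}^\alpha$ is a fixed measurable selection. *)

theory Defs
  imports "HOL-Probability.Probability"
begin

text \<open>
  Moments, transport costs and the objective are Lebesgue integrals valued in
  \<^typ>\<open>ennreal\<close>. No moment condition is imposed on the data measure, so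
  they may be infinite.
\<close>

definition ennreal_powr :: "ennreal \<Rightarrow> real \<Rightarrow> ennreal" where
  "ennreal_powr x a = (if x = \<top> then \<top> else ennreal (enn2real x powr a))"
  \<comment> \<open>The convention at \<open>\<top>\<close> is meant for \<open>a > 0\<close>.\<close>

definition prob_measures_on :: "'a::topological_space set \<Rightarrow> 'a measure set" where
  "prob_measures_on S = {\<mu>. prob_space \<mu> \<and> sets \<mu> = sets (restrict_space borel S)}"

definition prob_measures_moment :: "real \<Rightarrow> 'a::real_normed_vector set \<Rightarrow> 'a measure set" where
  "prob_measures_moment p S = {\<mu> \<in> prob_measures_on S. (\<integral>\<^sup>+x. ennreal (norm x powr p) \<partial>\<mu>) < \<infinity>}"

definition couplings :: "'a measure \<Rightarrow> 'b measure \<Rightarrow> ('a \<times> 'b) measure set" where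
  "couplings \<mu> \<nu> = {\<gamma>. prob_space \<gamma> \<and> sets \<gamma> = sets (\<mu> \<Otimes>\<^sub>M \<nu>) \<and>
     distr \<gamma> \<mu> fst = \<mu> \<and> distr \<gamma> \<nu> snd = \<nu>}"

text \<open>
  The minimum over couplings is written as an infimum, which has the same value whenever the
  minimum is attained.
\<close>

definition wasserstein ::
  "real \<Rightarrow> 'a::real_normed_vector measure \<Rightarrow> 'a measure \<Rightarrow> ennreal" where
  "wasserstein p \<mu> \<nu> =
     ennreal_powr (INF \<gamma>\<in>couplings \<mu> \<nu>. \<integral>\<^sup>+(y, y'). ennreal (norm (y - y') powr p) \<partial>\<gamma>) (1 / p)"

definition regularized_objective ::
  "real \<Rightarrow> real \<Rightarrow> ('a::real_normed_vector \<Rightarrow> 'b::real_normed_vector) \<Rightarrow> 'b measure \<Rightarrow> 'a measure \<Rightarrow> ennreal"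
  where
  "regularized_objective p \<alpha> G \<rho>\<^sub>y \<rho>\<^sub>x =
     ennreal_powr (wasserstein p (distr \<rho>\<^sub>x borel G) \<rho>\<^sub>y) p
       + ennreal \<alpha> * (\<integral>\<^sup>+x. ennreal (norm x powr p) \<partial>\<rho>\<^sub>x)"

end

theory Submission
  imports Defs
begin

text \<open>
  Write \<open>c z y = |z - y|\<^sup>p\<close>, \<open>f x = \<alpha> |x|\<^sup>p\<close> and
  \<open>m y = c (G (F y)) y + f (F y)\<close>, the pointwise minimum over \<open>x \<in> \<Theta>\<close> of \<open>c (G x) y + f x\<close>.
  The common value against which both sides are compared is \<open>\<integral> m d\<rho>\<^sub>y\<close>.

  The push-forward of \<open>\<rho>\<^sub>y\<close> under \<open>F\<close> costs at most \<open>\<integral> m d\<rho>\<^sub>y\<close>, because the joint law of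
  \<open>(G (F y), y)\<close> is one particular coupling (lemma \<open>transport_cost_le_graph_coupling\<close>).

  Conversely, every admissible \<open>\<rho>\<^sub>x\<close> and every coupling \<open>\<gamma>\<close> of its image under \<open>G\<close> with \<open>\<rho>\<^sub>y\<close>
  cost at least \<open>\<integral> m d\<rho>\<^sub>y\<close>. The pointwise inequality \<open>m y \<le> c (G x) y + f x\<close> cannot be integrated
  directly, because \<open>\<gamma>\<close> relates \<open>y\<close> to \<open>z = G x\<close> and not to \<open>x\<close>. Kantorovich weak duality separates
  the variables: the function \<open>k z = sup\<^sub>y max 0 (m y - c z y)\<close> satisfies both
  \<open>m y \<le> c z y + k z\<close> for all \<open>z\<close>, \<open>y\<close> and \<open>k (G x) \<le> f x\<close> for all \<open>x \<in> \<Theta>\<close>. The first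
  inequality is integrated against \<open>\<gamma>\<close>, the second against \<open>\<rho>\<^sub>x\<close>, and the two integrals of \<open>k\<close>
  agree since both are integrals with respect to the image of \<open>\<rho>\<^sub>x\<close>
  (lemma \<open>nn_integral_le_transport_plus_penalty\<close>).
\<close>

lemma ennreal_powr_inverse_powr:
  assumes "p > 0"
  shows "ennreal_powr (ennreal_powr I (1 / p)) p = I"
  using assms by (cases I) (auto simp: ennreal_powr_def powr_powr)

lemma regularized_objective_eq_INF:
  assumes "1 \<le> p"
  shows "regularized_objective p \<alpha> G \<rho>\<^sub>y \<rho>\<^sub>x =
    (INF \<gamma>\<in>couplings (distr \<rho>\<^sub>x borel G) \<rho>\<^sub>y. \<integral>\<^sup>+(z, y). ennreal (norm (z - y) powr p) \<partial>\<gamma>)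
      + ennreal \<alpha> * (\<integral>\<^sup>+x. ennreal (norm x powr p) \<partial>\<rho>\<^sub>x)"
  using assms by (simp add: regularized_objective_def wasserstein_def ennreal_powr_inverse_powr)

lemma le_INF_add_const_ennreal:
  fixes f :: "'i \<Rightarrow> ennreal"
  assumes "\<And>i. i \<in> I \<Longrightarrow> a \<le> f i + c"
  shows "a \<le> (INF i\<in>I. f i) + c"
proof (cases "c = \<top>")
  case False
  then have "a - c \<le> f i" if "i \<in> I" for i
    using assms[OF that] by (simp add: ennreal_minus_le_iff add.commute)
  then have "a - c \<le> (INF i\<in>I. f i)"
    by (rule INF_greatest)
  with False show ?thesis
    by (simp add: ennreal_minus_le_iff add.commute)
qed simp

lemma borel_measurable_norm_diff_powr [measurable]:
  "(\<lambda>(z, y). norm (z - y) powr p)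
     \<in> borel_measurable (borel \<Otimes>\<^sub>M (borel :: 'a::{second_countable_topology, real_normed_vector} measure))"
  by measurable

text \<open>
  A supremum of uncountably many functions need not be measurable, but a supremum of continuous
  ones is lower semicontinuous: its strict superlevel sets are unions of open sets.
\<close>

lemma borel_measurable_SUP_continuous:
  fixes u :: "'i \<Rightarrow> 'a::topological_space \<Rightarrow> ennreal"
  assumes "\<And>i. i \<in> I \<Longrightarrow> continuous_on UNIV (u i)"
  shows "(\<lambda>x. SUP i\<in>I. u i x) \<in> borel_measurable borel"
proof (rule borel_measurableI_greater)
  fix a
  have "open (\<Union>i\<in>I. {x. a < u i x})"
    using assms by (intro open_UN ballI open_Collect_less continuous_on_const) auto
  moreover have "{x \<in> space borel. a < (SUP i\<in>I. u i x)} = (\<Union>i\<in>I. {x. a < u i x})"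
    by (auto simp: less_SUP_iff)
  ultimately show "{x \<in> space borel. a < (SUP i\<in>I. u i x)} \<in> sets borel"
    by simp
qed

text \<open>
  Weak duality. The potential \<open>k\<close> in the proof is the truncated \<open>c\<close>-transform of \<open>m\<close>, the smallest
  \<^typ>\<open>ennreal\<close>-valued function with \<open>m y \<le> c z y + k z\<close>. It depends on \<open>z\<close> alone, so its
  integral against \<open>\<gamma>\<close> sees only the first marginal, the image of \<open>\<rho>\<^sub>x\<close>, and therefore equals the
  integral of \<open>k \<circ> G\<close> against \<open>\<rho>\<^sub>x\<close>. Continuity of the cost in \<open>z\<close> makes \<open>k\<close> measurable.
\<close>

lemma nn_integral_le_transport_plus_penalty:
  fixes c :: "'b::topological_space \<Rightarrow> 'c::topological_space \<Rightarrow> real"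
    and m :: "'c \<Rightarrow> real" and f :: "'a \<Rightarrow> real"
  assumes \<gamma>: "\<gamma> \<in> couplings (distr \<rho>\<^sub>x borel G) \<rho>\<^sub>y"
    and sets_\<rho>\<^sub>y [measurable_cong]: "sets \<rho>\<^sub>y = sets borel"
    and [measurable]: "G \<in> \<rho>\<^sub>x \<rightarrow>\<^sub>M borel" "m \<in> borel_measurable borel"
      "(\<lambda>(z, y). c z y) \<in> borel_measurable (borel \<Otimes>\<^sub>M borel)"
    and cont: "\<And>y. continuous_on UNIV (\<lambda>z. c z y)"
    and c_nonneg: "\<And>z y. 0 \<le> c z y"
    and le: "\<And>x y. x \<in> space \<rho>\<^sub>x \<Longrightarrow> m y \<le> c (G x) y + f x"
  shows "(\<integral>\<^sup>+y. m y \<partial>\<rho>\<^sub>y) \<le> (\<integral>\<^sup>+(z, y). ennreal (c z y) \<partial>\<gamma>) + (\<integral>\<^sup>+x. f x \<partial>\<rho>\<^sub>x)"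
proof -
  let ?\<mu> = "distr \<rho>\<^sub>x borel G"
  define k where "k z = (SUP y. ennreal (m y - c z y))" for z
  have [measurable]: "k \<in> borel_measurable borel"
    unfolding k_def using cont
    by (intro borel_measurable_SUP_continuous continuous_on_ennreal continuous_on_diff) auto
  have sets_\<gamma>: "sets \<gamma> = sets (?\<mu> \<Otimes>\<^sub>M \<rho>\<^sub>y)"
    and fst_\<gamma>: "distr \<gamma> ?\<mu> fst = ?\<mu>" and snd_\<gamma>: "distr \<gamma> \<rho>\<^sub>y snd = \<rho>\<^sub>y"
    using \<gamma> by (auto simp: couplings_def)
  have [measurable_cong]: "sets \<gamma> = sets (borel \<Otimes>\<^sub>M borel)"
    unfolding sets_\<gamma> by (intro sets_pair_measure_cong) (auto simp: sets_\<rho>\<^sub>y)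
  have m_le: "ennreal (m y) \<le> ennreal (c z y) + k z" for y z
  proof -
    have "ennreal (m y) \<le> ennreal (c z y + max 0 (m y - c z y))"
      by (intro ennreal_leI) auto
    also have "\<dots> = ennreal (c z y) + ennreal (m y - c z y)"
      using c_nonneg by (subst ennreal_plus) (auto simp: max_def ennreal_neg)
    also have "\<dots> \<le> ennreal (c z y) + k z"
      unfolding k_def by (intro add_left_mono SUP_upper) auto
    finally show ?thesis .
  qed
  have k_le: "k (G x) \<le> ennreal (f x)" if "x \<in> space \<rho>\<^sub>x" for x
    unfolding k_def using le[OF that] by (intro SUP_least ennreal_leI) (simp add: algebra_simps)
  have "(\<integral>\<^sup>+y. m y \<partial>\<rho>\<^sub>y) = (\<integral>\<^sup>+y. m y \<partial>distr \<gamma> \<rho>\<^sub>y snd)"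
    by (simp add: snd_\<gamma>)
  also have "\<dots> = (\<integral>\<^sup>+w. m (snd w) \<partial>\<gamma>)"
    by (intro nn_integral_distr) measurable
  also have "\<dots> \<le> (\<integral>\<^sup>+w. ennreal (case w of (z, y) \<Rightarrow> c z y) + k (fst w) \<partial>\<gamma>)"
    using m_le by (intro nn_integral_mono) (auto split: prod.split)
  also have "\<dots> = (\<integral>\<^sup>+w. ennreal (case w of (z, y) \<Rightarrow> c z y) \<partial>\<gamma>) + (\<integral>\<^sup>+w. k (fst w) \<partial>\<gamma>)"
    by (intro nn_integral_add) measurable
  also have "(\<integral>\<^sup>+w. k (fst w) \<partial>\<gamma>) = (\<integral>\<^sup>+z. k z \<partial>distr \<gamma> ?\<mu> fst)"
    by (intro nn_integral_distr[symmetric]) measurable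
  also have "\<dots> = (\<integral>\<^sup>+x. k (G x) \<partial>\<rho>\<^sub>x)"
    unfolding fst_\<gamma> by (intro nn_integral_distr) measurable
  also have "\<dots> \<le> (\<integral>\<^sup>+x. f x \<partial>\<rho>\<^sub>x)"
    by (intro nn_integral_mono k_le)
  finally show ?thesis
    by (simp add: case_prod_unfold add_left_mono)
qed

text \<open>
  Transporting \<open>T y\<close> back to \<open>y\<close> for every \<open>y\<close> is an admissible plan between the image of \<open>\<nu>\<close>
  under \<open>T\<close> and \<open>\<nu>\<close>.
\<close>

lemma transport_cost_le_graph_coupling:
  fixes T :: "'c::topological_space \<Rightarrow> 'b::topological_space" and c :: "'b \<Rightarrow> 'c \<Rightarrow> ennreal"
  assumes "prob_space \<nu>" and [measurable_cong]: "sets \<nu> = sets borel"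
    and [measurable]: "T \<in> borel \<rightarrow>\<^sub>M borel"
      "(\<lambda>(z, y). c z y) \<in> borel_measurable (borel \<Otimes>\<^sub>M borel)"
  shows "(INF \<gamma>\<in>couplings (distr \<nu> borel T) \<nu>. \<integral>\<^sup>+(z, y). c z y \<partial>\<gamma>) \<le> (\<integral>\<^sup>+y. c (T y) y \<partial>\<nu>)"
proof -
  interpret prob_space \<nu> by fact
  define \<gamma> where "\<gamma> = distr \<nu> (borel \<Otimes>\<^sub>M borel) (\<lambda>y. (T y, y))"
  have "prob_space \<gamma>"
    unfolding \<gamma>_def by (intro prob_space_distr) measurable
  moreover have "sets \<gamma> = sets (distr \<nu> borel T \<Otimes>\<^sub>M \<nu>)"
    unfolding \<gamma>_def by (simp, intro sets_pair_measure_cong) (auto simp: assms(2))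
  moreover have "distr \<gamma> (distr \<nu> borel T) fst = distr \<nu> borel T"
    unfolding \<gamma>_def by (subst distr_distr) (auto simp: comp_def intro!: distr_cong)
  moreover have "distr \<gamma> \<nu> snd = \<nu>"
    unfolding \<gamma>_def by (subst distr_distr) (auto simp: comp_def distr_id2)
  ultimately have "\<gamma> \<in> couplings (distr \<nu> borel T) \<nu>"
    by (simp add: couplings_def)
  moreover have "(\<integral>\<^sup>+(z, y). c z y \<partial>\<gamma>) = (\<integral>\<^sup>+y. c (T y) y \<partial>\<nu>)"
    unfolding \<gamma>_def by (subst nn_integral_distr) auto
  ultimately show ?thesis
    by (intro INF_lower2[of \<gamma>]) auto
qed

lemma prob_measure_moment_of_bounded:
  fixes S :: "'a::real_normed_vector set"
  assumes "\<mu> \<in> prob_measures_on S" and "bounded S" and "0 \<le> p"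
  shows "\<mu> \<in> prob_measures_moment p S"
proof -
  interpret prob_space \<mu> using assms(1) by (simp add: prob_measures_on_def)
  have space: "space \<mu> = S"
    using assms(1) sets_eq_imp_space_eq[of \<mu> "restrict_space borel S"]
    by (simp add: prob_measures_on_def space_restrict_space)
  obtain B where B: "\<And>x. x \<in> S \<Longrightarrow> norm x \<le> B"
    using assms(2) by (auto simp: bounded_iff)
  have "(\<integral>\<^sup>+x. ennreal (norm x powr p) \<partial>\<mu>) \<le> (\<integral>\<^sup>+x. ennreal (B powr p) \<partial>\<mu>)"
    using B assms(3) by (intro nn_integral_mono ennreal_leI powr_mono2) (auto simp: space)
  also have "\<dots> < \<infinity>"
    by (simp add: emeasure_space_1)
  finally show ?thesis
    using assms(1) by (simp add: prob_measures_moment_def)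
qed

theorem theorem4p3:
  fixes p \<alpha> :: real
    and \<Theta> :: "(real ^ 'm) set"
    and G :: "real ^ 'm \<Rightarrow> real ^ 'n"
    and F :: "real ^ 'n \<Rightarrow> real ^ 'm"
    and \<rho>\<^sub>y :: "(real ^ 'n) measure"
  assumes "1 \<le> p" and "\<alpha> > 0"
    and "\<rho>\<^sub>y \<in> prob_measures_on UNIV"
    and "G \<in> restrict_space borel \<Theta> \<rightarrow>\<^sub>M borel"
    and "compact \<Theta>" and "compact (G ` \<Theta>)"
    and "F \<in> borel \<rightarrow>\<^sub>M restrict_space borel \<Theta>"
    and "\<And>y. is_arg_min (\<lambda>x. norm (G x - y) powr p + \<alpha> * norm x powr p) (\<lambda>x. x \<in> \<Theta>) (F y)"
  shows "is_arg_min (regularized_objective p \<alpha> G \<rho>\<^sub>y) (\<lambda>\<rho>\<^sub>x. \<rho>\<^sub>x \<in> prob_measures_moment p \<Theta>)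
           (distr \<rho>\<^sub>y (restrict_space borel \<Theta>) F)"
proof -
  have "prob_space \<rho>\<^sub>y" and sets_\<rho>\<^sub>y [measurable_cong]: "sets \<rho>\<^sub>y = sets borel"
    using assms(3) by (auto simp: prob_measures_on_def)
  interpret prob_space \<rho>\<^sub>y by fact
  note [measurable] = assms(4,7)
  have F_meas [measurable]: "F \<in> borel_measurable borel"
    using assms(7) by (simp add: measurable_restrict_space2_iff)
  have GF_meas [measurable]: "(\<lambda>y. G (F y)) \<in> borel_measurable borel"
    using measurable_comp[OF assms(7,4)] by (simp add: comp_def)
  have id_meas [measurable]: "(\<lambda>x. x) \<in> restrict_space borel \<Theta> \<rightarrow>\<^sub>M borel"
    by (intro measurable_restrict_space1) simp
  let ?\<rho> = "distr \<rho>\<^sub>y (restrict_space borel \<Theta>) F"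
  let ?J = "regularized_objective p \<alpha> G \<rho>\<^sub>y"
  define m where "m y = norm (G (F y) - y) powr p + \<alpha> * norm (F y) powr p" for y
  have m_meas [measurable]: "m \<in> borel_measurable borel"
    unfolding m_def by measurable
  have m_le: "m y \<le> norm (G x - y) powr p + \<alpha> * norm x powr p" if "x \<in> \<Theta>" for x y
    using assms(8)[of y] that by (auto simp: is_arg_min_def m_def not_less)

  have "?\<rho> \<in> prob_measures_on \<Theta>"
    by (auto simp: prob_measures_on_def intro!: prob_space_distr)
  then have admissible: "?\<rho> \<in> prob_measures_moment p \<Theta>"
    using assms(1,5) by (intro prob_measure_moment_of_bounded compact_imp_bounded) auto

  have upper: "?J ?\<rho> \<le> (\<integral>\<^sup>+y. m y \<partial>\<rho>\<^sub>y)"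
  proof -
    have "distr ?\<rho> borel G = distr \<rho>\<^sub>y borel (\<lambda>y. G (F y))"
      by (subst distr_distr) (auto simp: comp_def)
    then have "?J ?\<rho> \<le> (\<integral>\<^sup>+y. norm (G (F y) - y) powr p \<partial>\<rho>\<^sub>y)
        + ennreal \<alpha> * (\<integral>\<^sup>+x. ennreal (norm x powr p) \<partial>?\<rho>)"
      unfolding regularized_objective_eq_INF[OF assms(1)]
      using transport_cost_le_graph_coupling[OF \<open>prob_space \<rho>\<^sub>y\<close> sets_\<rho>\<^sub>y GF_meas,
          of "\<lambda>z y. ennreal (norm (z - y) powr p)"]
      by (auto intro!: add_right_mono)
    also have "(\<integral>\<^sup>+x. ennreal (norm x powr p) \<partial>?\<rho>) = (\<integral>\<^sup>+y. norm (F y) powr p \<partial>\<rho>\<^sub>y)"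
      by (intro nn_integral_distr) measurable
    also have "(\<integral>\<^sup>+y. norm (G (F y) - y) powr p \<partial>\<rho>\<^sub>y) + ennreal \<alpha> * (\<integral>\<^sup>+y. norm (F y) powr p \<partial>\<rho>\<^sub>y)
        = (\<integral>\<^sup>+y. m y \<partial>\<rho>\<^sub>y)"
      unfolding m_def using assms(2)
      by (simp add: nn_integral_add nn_integral_cmult ennreal_mult)
    finally show ?thesis .
  qed

  have lower: "(\<integral>\<^sup>+y. m y \<partial>\<rho>\<^sub>y) \<le> ?J \<rho>\<^sub>x" if "\<rho>\<^sub>x \<in> prob_measures_moment p \<Theta>" for \<rho>\<^sub>x
  proof -
    have sets_\<rho>\<^sub>x [measurable_cong]: "sets \<rho>\<^sub>x = sets (restrict_space borel \<Theta>)"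
      using that by (simp add: prob_measures_moment_def prob_measures_on_def)
    have space: "space \<rho>\<^sub>x = \<Theta>"
      using sets_eq_imp_space_eq[OF sets_\<rho>\<^sub>x] by (simp add: space_restrict_space)
    have G_meas: "G \<in> \<rho>\<^sub>x \<rightarrow>\<^sub>M borel"
      by measurable
    let ?C = "couplings (distr \<rho>\<^sub>x borel G) \<rho>\<^sub>y"
    have penalty: "(\<integral>\<^sup>+x. \<alpha> * norm x powr p \<partial>\<rho>\<^sub>x) = ennreal \<alpha> * (\<integral>\<^sup>+x. norm x powr p \<partial>\<rho>\<^sub>x)"
      using assms(2) by (simp add: nn_integral_cmult ennreal_mult)
    have cont: "continuous_on UNIV (\<lambda>z. norm (z - y) powr p)" for y :: "real ^ 'n"
      using assms(1) by (intro continuous_on_powr' continuous_intros) auto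
    have "(\<integral>\<^sup>+y. m y \<partial>\<rho>\<^sub>y)
        \<le> (\<integral>\<^sup>+(z, y). ennreal (norm (z - y) powr p) \<partial>\<gamma>) + (\<integral>\<^sup>+x. \<alpha> * norm x powr p \<partial>\<rho>\<^sub>x)"
      if "\<gamma> \<in> ?C" for \<gamma>
      using m_le
      by (intro nn_integral_le_transport_plus_penalty[OF that sets_\<rho>\<^sub>y G_meas m_meas
            borel_measurable_norm_diff_powr cont]) (auto simp: space)
    then show ?thesis
      unfolding regularized_objective_eq_INF[OF assms(1)] penalty
      by (rule le_INF_add_const_ennreal)
  qed
  show ?thesis
    using admissible upper lower by (auto simp: is_arg_min_def not_less intro: order_trans)
qed

end
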